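(* Let $n\geq 6$ be an integer. Then the following hold. (1) If $n$ is even, then $$\mathrm{S}_{\mathrm{Dic}_{4n}}(2n)\geq (n+1)\bigl(7\cdot 2^{n-3}-4\bigr),\qquad \mathrm{D}_{\mathrm{Dic}_{4n}}(2n)\geq 2(n+1),\qquad \mathrm{B}_{\mathrm{Dic}_{4n}}(2n)\geq (n+1)\sum_{\substack{i=3\\ i\text{ odd}}}^{n+3}\binom{2n-i}{n-3}.$$ (2) If $n$ is odd, then $$\mathrm{S}_{\mathrm{Dic}_{4n}}(2n)\geq (n+1)\bigl(7\cdot 2^{n-3}-4\bigr),\qquad \mathrm{D}_{\mathrm{Dic}_{4n}}(2n)\geq 0,\qquad \mathrm{B}_{\mathrm{Dic}_{4n}}(2n)\geq \binom{2n}{n}(n+1)-2^{n}(n+1).$$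
   Context: For a positive integer $n$, the dicyclic group is $\mathrm{Dic}_{4n}=\langle a,b : a^{2n}=1,\ a^{n}=b^2,\ b^{-1}ab=a^{-1}\rangle$, a group of order $4n$ with elements $1,a,\dots,a^{2n-1},b,ab,\dots,a^{2n-1}b$. For a subset $A$ of a finite (multiplicatively written) group, put $A+A=\{a_1a_2: a_1,a_2\in A\}$ and $A-A=\{a_1a_2^{-1}: a_1,a_2\in A\}$. The set $A$ is MSTD if $|A+A|>|A-A|$, balanced if $|A+A|=|A-A|$, and MDTS if $|A+A|<|A-A|$. For $k\in\mathbb{N}$, $\mathrm{S}_{\mathrm{Dic}_{4n}}(k)$, $\mathrm{D}_{\mathrm{Dic}_{4n}}(k)$, $\mathrm{B}_{\mathrm{Dic}_{4n}}(k)$ denote the numbers of MSTD, MDTS, and balanced subsets of $\mathrm{Dic}_{4n}$ of cardinality $k$, respectively. *)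

theory Defs
  imports "HOL-Algebra.Coset"
begin

text \<open>
  A word over the generators \<open>'g\<close> is a list of letters; the letter \<open>(x, True)\<close> stands for the
  generator \<open>x\<close> and \<open>(x, False)\<close> for its formal inverse. A relation \<open>u = v\<close> is given as the pair
  \<open>(u, v)\<close> of words.
\<close>

type_synonym 'g word = "('g \<times> bool) list"

inductive pres_eq :: "('g word \<times> 'g word) set \<Rightarrow> 'g word \<Rightarrow> 'g word \<Rightarrow> bool"
  for R :: "('g word \<times> 'g word) set"
where
  refl: "pres_eq R u u"
| sym: "pres_eq R u v \<Longrightarrow> pres_eq R v u"
| trans: "pres_eq R u v \<Longrightarrow> pres_eq R v w \<Longrightarrow> pres_eq R u w"
| append: "pres_eq R u u' \<Longrightarrow> pres_eq R v v' \<Longrightarrow> pres_eq R (u @ v) (u' @ v')"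
| cancel: "pres_eq R [(x, e), (x, \<not> e)] []"
| rel: "(u, v) \<in> R \<Longrightarrow> pres_eq R u v"

definition pres_class :: "('g word \<times> 'g word) set \<Rightarrow> 'g word \<Rightarrow> 'g word set" where
  "pres_class R u = {v. pres_eq R u v}"

text \<open>The group generated by the elements of \<open>'g\<close> subject to the relations \<open>R\<close>.\<close>

definition presented_group :: "('g word \<times> 'g word) set \<Rightarrow> 'g word set monoid" where
  "presented_group R =
    \<lparr>carrier = range (pres_class R),
     mult = (\<lambda>U V. {w. \<exists>u\<in>U. \<exists>v\<in>V. pres_eq R (u @ v) w}),
     one = pres_class R []\<rparr>"

lemma pres_class_eq_iff: "pres_class R u = pres_class R v \<longleftrightarrow> pres_eq R u v"
  unfolding pres_class_def by (auto intro: pres_eq.refl pres_eq.sym pres_eq.trans)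

lemma carrier_presented_group: "carrier (presented_group R) = range (pres_class R)"
  by (simp add: presented_group_def)

lemma one_presented_group: "\<one>\<^bsub>presented_group R\<^esub> = pres_class R []"
  by (simp add: presented_group_def)

lemma mult_presented_group:
  "pres_class R u \<otimes>\<^bsub>presented_group R\<^esub> pres_class R v = pres_class R (u @ v)"
proof -
  have "{w. \<exists>u'\<in>pres_class R u. \<exists>v'\<in>pres_class R v. pres_eq R (u' @ v') w}
      = pres_class R (u @ v)"
    unfolding pres_class_def
    by (auto intro: pres_eq.trans pres_eq.append pres_eq.refl)
  then show ?thesis by (simp add: presented_group_def)
qed

lemma pres_eq_left_inverse: "\<exists>v. pres_eq R (v @ u) []"
proof (induction u)
  case Nil
  show ?case by (rule exI[of _ "[]"]) (simp add: pres_eq.refl)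
next
  case (Cons l u)
  obtain v where v: "pres_eq R (v @ u) []" using Cons by blast
  obtain x e where l: "l = (x, e)" by (cases l)
  have "pres_eq R [(x, \<not> e), (x, e)] []"
    using pres_eq.cancel[of R x "\<not> e"] by simp
  then have "pres_eq R (v @ ([(x, \<not> e), (x, e)] @ u)) (v @ ([] @ u))"
    by (intro pres_eq.append pres_eq.refl)
  then have "pres_eq R ((v @ [(x, \<not> e)]) @ l # u) []"
    using v l by (auto intro: pres_eq.trans)
  then show ?case by blast
qed

lemma group_presented_group: "group (presented_group R)"
proof (rule groupI)
  fix X assume "X \<in> carrier (presented_group R)"
  then obtain u where u: "X = pres_class R u" by (auto simp: carrier_presented_group)
  obtain v where "pres_eq R (v @ u) []" using pres_eq_left_inverse by blast
  then show "\<exists>Y\<in>carrier (presented_group R). Y \<otimes>\<^bsub>presented_group R\<^esub> X = \<one>\<^bsub>presented_group R\<^esub>"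
    using u by (auto simp: carrier_presented_group mult_presented_group one_presented_group
        pres_class_eq_iff)
qed (auto simp: carrier_presented_group mult_presented_group one_presented_group)

datatype dic_gen = GenA | GenB

text \<open>\<open>dicyclic n\<close> is the dicyclic group of order \<open>4 * n\<close> (for \<open>n > 0\<close>).\<close>

definition dicyclic_rels :: "nat \<Rightarrow> (dic_gen word \<times> dic_gen word) set" where
  "dicyclic_rels n =
    {(replicate (2 * n) (GenA, True), []),
     (replicate n (GenA, True), [(GenB, True), (GenB, True)]),
     ([(GenB, False), (GenA, True), (GenB, True)], [(GenA, False)])}"

definition dicyclic :: "nat \<Rightarrow> dic_gen word set monoid" where
  "dicyclic n = presented_group (dicyclic_rels n)"

definition dic_a :: "nat \<Rightarrow> dic_gen word set" where
  "dic_a n = pres_class (dicyclic_rels n) [(GenA, True)]"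

definition dic_b :: "nat \<Rightarrow> dic_gen word set" where
  "dic_b n = pres_class (dicyclic_rels n) [(GenB, True)]"

text \<open>
  The sets written additively as \<open>A + A\<close> and \<open>A - A\<close> are, in the multiplicative group \<open>G\<close>,
  \<open>A <#> A\<close> and \<open>A <#> set_inv A\<close>.
\<close>

definition sum_set :: "('a, 'b) monoid_scheme \<Rightarrow> 'a set \<Rightarrow> 'a set" where
  "sum_set G A = A <#>\<^bsub>G\<^esub> A"

definition diff_set :: "('a, 'b) monoid_scheme \<Rightarrow> 'a set \<Rightarrow> 'a set" where
  "diff_set G A = A <#>\<^bsub>G\<^esub> (set_inv\<^bsub>G\<^esub> A)"

lemma sum_set_eq: "sum_set G A = {x \<otimes>\<^bsub>G\<^esub> y |x y. x \<in> A \<and> y \<in> A}"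
  unfolding sum_set_def set_mult_def by auto

lemma diff_set_eq: "diff_set G A = {x \<otimes>\<^bsub>G\<^esub> inv\<^bsub>G\<^esub> y |x y. x \<in> A \<and> y \<in> A}"
  unfolding diff_set_def set_mult_def SET_INV_def by auto

definition MSTD :: "('a, 'b) monoid_scheme \<Rightarrow> 'a set \<Rightarrow> bool" where
  "MSTD G A \<longleftrightarrow> card (sum_set G A) > card (diff_set G A)"

definition balanced :: "('a, 'b) monoid_scheme \<Rightarrow> 'a set \<Rightarrow> bool" where
  "balanced G A \<longleftrightarrow> card (sum_set G A) = card (diff_set G A)"

definition MDTS :: "('a, 'b) monoid_scheme \<Rightarrow> 'a set \<Rightarrow> bool" where
  "MDTS G A \<longleftrightarrow> card (sum_set G A) < card (diff_set G A)"

definition num_MSTD :: "('a, 'b) monoid_scheme \<Rightarrow> nat \<Rightarrow> nat" where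
  "num_MSTD G k = card {A. A \<subseteq> carrier G \<and> card A = k \<and> MSTD G A}"

definition num_MDTS :: "('a, 'b) monoid_scheme \<Rightarrow> nat \<Rightarrow> nat" where
  "num_MDTS G k = card {A. A \<subseteq> carrier G \<and> card A = k \<and> MDTS G A}"

definition num_balanced :: "('a, 'b) monoid_scheme \<Rightarrow> nat \<Rightarrow> nat" where
  "num_balanced G k = card {A. A \<subseteq> carrier G \<and> card A = k \<and> balanced G A}"


subsection \<open>Basic facts about the dicyclic group\<close>

lemma group_dicyclic: "group (dicyclic n)"
  by (simp add: dicyclic_def group_presented_group)

lemma dic_a_closed: "dic_a n \<in> carrier (dicyclic n)"
  and dic_b_closed: "dic_b n \<in> carrier (dicyclic n)"
  by (auto simp: dicyclic_def dic_a_def dic_b_def carrier_presented_group)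

lemma pow_presented_group:
  "pres_class R [l] [^]\<^bsub>presented_group R\<^esub> (k::nat) = pres_class R (replicate k l)"
proof (induction k)
  case 0
  then show ?case by (simp add: one_presented_group)
next
  case (Suc k)
  have "replicate k l @ [l] = replicate (Suc k) l" by (simp add: replicate_append_same)
  then show ?case using Suc by (simp add: mult_presented_group)
qed

lemma inv_letter_presented_group:
  "inv\<^bsub>presented_group R\<^esub> (pres_class R [(x, e)]) = pres_class R [(x, \<not> e)]"
proof -
  interpret group "presented_group R" by (rule group_presented_group)
  have "pres_class R [(x, \<not> e)] \<otimes>\<^bsub>presented_group R\<^esub> pres_class R [(x, e)] = \<one>\<^bsub>presented_group R\<^esub>"
    using pres_eq.cancel[of R x "\<not> e"]
    by (simp add: mult_presented_group one_presented_group pres_class_eq_iff)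
  then show ?thesis by (intro inv_equality) (auto simp: carrier_presented_group)
qed

lemma dicyclic_relations:
  "dic_a n [^]\<^bsub>dicyclic n\<^esub> (2 * n) = \<one>\<^bsub>dicyclic n\<^esub>"
  "dic_a n [^]\<^bsub>dicyclic n\<^esub> n = dic_b n [^]\<^bsub>dicyclic n\<^esub> (2::nat)"
  "inv\<^bsub>dicyclic n\<^esub> (dic_b n) \<otimes>\<^bsub>dicyclic n\<^esub> dic_a n \<otimes>\<^bsub>dicyclic n\<^esub> dic_b n
    = inv\<^bsub>dicyclic n\<^esub> (dic_a n)"
  unfolding dicyclic_def dic_a_def dic_b_def pow_presented_group inv_letter_presented_group
    one_presented_group mult_presented_group pres_class_eq_iff
  by (auto simp: dicyclic_rels_def numeral_2_eq_2 intro!: pres_eq.rel)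


text \<open>
  To see that the elements \<open>a\<^sup>i b\<^sup>j\<close> with \<open>i < 2 n\<close>, \<open>j < 2\<close> are pairwise distinct, let the letters
  act by left multiplication on the normal forms, where \<open>(i, False)\<close> stands for \<open>a\<^sup>i\<close> and
  \<open>(i, True)\<close> for \<open>a\<^sup>i b\<close>.
\<close>

fun dic_act :: "nat \<Rightarrow> dic_gen \<times> bool \<Rightarrow> int \<times> bool \<Rightarrow> int \<times> bool" where
  "dic_act n (GenA, True) (i, e) = ((i + 1) mod (2 * int n), e)"
| "dic_act n (GenA, False) (i, e) = ((i - 1) mod (2 * int n), e)"
| "dic_act n (GenB, True) (i, e) = ((if e then int n - i else - i) mod (2 * int n), \<not> e)"
| "dic_act n (GenB, False) (i, e) = ((if e then - i else int n - i) mod (2 * int n), \<not> e)"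

definition dic_nf :: "nat \<Rightarrow> (int \<times> bool) set" where
  "dic_nf n = {0..<2 * int n} \<times> UNIV"

lemma dic_act_closed: "n > 0 \<Longrightarrow> p \<in> dic_nf n \<Longrightarrow> dic_act n l p \<in> dic_nf n"
  by (cases "(n, l, p)" rule: dic_act.cases) (auto simp: dic_nf_def)

lemma dic_act_word_closed: "n > 0 \<Longrightarrow> p \<in> dic_nf n \<Longrightarrow> foldr (dic_act n) u p \<in> dic_nf n"
  by (induction u) (auto simp: dic_act_closed)

lemma dic_act_cancel:
  assumes "p \<in> dic_nf n"
  shows "dic_act n (x, e) (dic_act n (x, \<not> e) p) = p"
proof -
  obtain i f where p: "p = (i, f)" by (cases p)
  have i: "i mod (2 * int n) = i" using assms by (auto simp: p dic_nf_def)
  show ?thesis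
    by (cases x; cases e; cases f) (simp_all add: p i mod_simps)
qed

lemma dic_act_replicate:
  assumes "p \<in> dic_nf n"
  shows "foldr (dic_act n) (replicate k (GenA, True)) p = ((fst p + int k) mod (2 * int n), snd p)"
proof (induction k)
  case 0
  show ?case using assms by (cases p) (auto simp: dic_nf_def)
next
  case (Suc k)
  then show ?case by (simp add: mod_simps algebra_simps)
qed

lemma dic_act_rels:
  assumes "(u, v) \<in> dicyclic_rels n" "p \<in> dic_nf n"
  shows "foldr (dic_act n) u p = foldr (dic_act n) v p"
proof -
  obtain i f where p: "p = (i, f)" by (cases p)
  have i: "i mod (2 * int n) = i" using assms by (auto simp: p dic_nf_def)
  consider "u = replicate (2 * n) (GenA, True)" "v = []"
    | "u = replicate n (GenA, True)" "v = [(GenB, True), (GenB, True)]"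
    | "u = [(GenB, False), (GenA, True), (GenB, True)]" "v = [(GenA, False)]"
    using assms(1) by (auto simp: dicyclic_rels_def)
  then show ?thesis
  proof cases
    case 1
    then show ?thesis using dic_act_replicate[OF assms(2)] by (simp add: p i)
  next
    case 2
    have "(i + int n) mod (int n * 2) = (i - int n) mod (int n * 2)"
      by (simp add: mod_eq_dvd_iff algebra_simps)
    with 2 show ?thesis using dic_act_replicate[OF assms(2)]
      by (cases f) (simp_all add: p i mod_simps algebra_simps)
  next
    case 3
    then show ?thesis by (cases f) (simp_all add: p mod_simps algebra_simps)
  qed
qed

lemma dic_act_pres_eq:
  assumes "n > 0" "pres_eq (dicyclic_rels n) u v" "p \<in> dic_nf n"
  shows "foldr (dic_act n) u p = foldr (dic_act n) v p"
  using assms(2,3)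
proof (induction arbitrary: p rule: pres_eq.induct)
  case (append u u' v v')
  then show ?case using dic_act_word_closed[OF assms(1)] by simp
qed (simp_all add: dic_act_cancel dic_act_rels)

definition dic_word :: "nat \<Rightarrow> nat \<Rightarrow> dic_gen word" where
  "dic_word i j = replicate i (GenA, True) @ replicate j (GenB, True)"

lemma dic_word_class:
  "dic_a n [^]\<^bsub>dicyclic n\<^esub> i \<otimes>\<^bsub>dicyclic n\<^esub> dic_b n [^]\<^bsub>dicyclic n\<^esub> j
    = pres_class (dicyclic_rels n) (dic_word i j)"
  by (simp add: dicyclic_def dic_a_def dic_b_def pow_presented_group mult_presented_group dic_word_def)

lemma dic_act_dic_word:
  assumes "n > 0" "i < 2 * n" "j < 2"
  shows "foldr (dic_act n) (dic_word i j) (0, False) = (int i, j = 1)"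
proof -
  have j: "foldr (dic_act n) (replicate j (GenB, True)) (0, False) = (0, j = 1)"
    using assms by (cases j) auto
  have "(0, j = 1) \<in> dic_nf n" using assms by (auto simp: dic_nf_def)
  from dic_act_replicate[OF this] show ?thesis
    using assms j by (simp add: dic_word_def del: foldr_replicate)
qed

lemma inj_on_dicyclic_elements:
  assumes "n > 0"
  shows "inj_on (\<lambda>(i, j). dic_a n [^]\<^bsub>dicyclic n\<^esub> i \<otimes>\<^bsub>dicyclic n\<^esub> dic_b n [^]\<^bsub>dicyclic n\<^esub> j)
    ({..<2 * n} \<times> {..<2::nat})"
proof (rule inj_onI, clarsimp simp: dic_word_class pres_class_eq_iff)
  fix i j i' j' :: nat
  assume *: "i < 2 * n" "i' < 2 * n" "j < 2" "j' < 2"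
    and eq: "pres_eq (dicyclic_rels n) (dic_word i j) (dic_word i' j')"
  have "(0, False) \<in> dic_nf n" using assms by (simp add: dic_nf_def)
  from dic_act_pres_eq[OF assms eq this] show "i = i' \<and> j = j'"
    using * assms by (auto simp: dic_act_dic_word)
qed

lemma dicyclic_elements:
  assumes "n > 0"
  shows "carrier (dicyclic n) =
    (\<lambda>(i, j). dic_a n [^]\<^bsub>dicyclic n\<^esub> i \<otimes>\<^bsub>dicyclic n\<^esub> dic_b n [^]\<^bsub>dicyclic n\<^esub> j)
      ` ({..<2 * n} \<times> {..<2::nat})" (is "_ = ?N")
proof -
  interpret group "dicyclic n" by (rule group_dicyclic)
  let ?G = "dicyclic n" and ?a = "dic_a n" and ?b = "dic_b n"
  note [simp] = dic_a_closed dic_b_closed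
  have NI: "?a [^]\<^bsub>?G\<^esub> k \<otimes>\<^bsub>?G\<^esub> ?b [^]\<^bsub>?G\<^esub> j \<in> ?N" if "j < 2" for k j :: nat
  proof -
    have "?a [^]\<^bsub>?G\<^esub> k = ?a [^]\<^bsub>?G\<^esub> (2 * n * (k div (2 * n)) + k mod (2 * n))" by simp
    also have "\<dots> = (?a [^]\<^bsub>?G\<^esub> (2 * n)) [^]\<^bsub>?G\<^esub> (k div (2 * n)) \<otimes>\<^bsub>?G\<^esub> ?a [^]\<^bsub>?G\<^esub> (k mod (2 * n))"
      by (simp only: nat_pow_mult nat_pow_pow dic_a_closed)
    also have "\<dots> = ?a [^]\<^bsub>?G\<^esub> (k mod (2 * n))"
      by (simp add: dicyclic_relations(1))
    finally show ?thesis using that assms by auto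
  qed
  have inva: "inv\<^bsub>?G\<^esub> ?a = ?a [^]\<^bsub>?G\<^esub> (2 * n - 1)"
  proof (rule inv_equality)
    have "?a [^]\<^bsub>?G\<^esub> (2 * n - 1) \<otimes>\<^bsub>?G\<^esub> ?a = ?a [^]\<^bsub>?G\<^esub> Suc (2 * n - 1)" by simp
    also have "Suc (2 * n - 1) = 2 * n" using assms by simp
    finally show "?a [^]\<^bsub>?G\<^esub> (2 * n - 1) \<otimes>\<^bsub>?G\<^esub> ?a = \<one>\<^bsub>?G\<^esub>"
      by (simp only: dicyclic_relations(1))
  qed simp_all
  have bb: "?b \<otimes>\<^bsub>?G\<^esub> ?b = ?a [^]\<^bsub>?G\<^esub> n"
    by (simp add: dicyclic_relations(2) numeral_2_eq_2)
  have invb: "inv\<^bsub>?G\<^esub> ?b = ?a [^]\<^bsub>?G\<^esub> n \<otimes>\<^bsub>?G\<^esub> ?b"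
  proof (rule inv_equality)
    have "?a [^]\<^bsub>?G\<^esub> n \<otimes>\<^bsub>?G\<^esub> ?b \<otimes>\<^bsub>?G\<^esub> ?b = ?a [^]\<^bsub>?G\<^esub> n \<otimes>\<^bsub>?G\<^esub> ?a [^]\<^bsub>?G\<^esub> n"
      by (simp add: m_assoc bb)
    also have "\<dots> = ?a [^]\<^bsub>?G\<^esub> (2 * n)" by (simp add: nat_pow_mult mult_2)
    finally show "?a [^]\<^bsub>?G\<^esub> n \<otimes>\<^bsub>?G\<^esub> ?b \<otimes>\<^bsub>?G\<^esub> ?b = \<one>\<^bsub>?G\<^esub>"
      by (simp only: dicyclic_relations(1))
  qed simp_all
  have "?b \<otimes>\<^bsub>?G\<^esub> (inv\<^bsub>?G\<^esub> ?b \<otimes>\<^bsub>?G\<^esub> ?a \<otimes>\<^bsub>?G\<^esub> ?b) = ?b \<otimes>\<^bsub>?G\<^esub> inv\<^bsub>?G\<^esub> ?a"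
    by (simp only: dicyclic_relations(3))
  then have ab: "?a \<otimes>\<^bsub>?G\<^esub> ?b = ?b \<otimes>\<^bsub>?G\<^esub> inv\<^bsub>?G\<^esub> ?a"
    by (simp add: m_assoc[symmetric])
  then have "?a \<otimes>\<^bsub>?G\<^esub> ?b \<otimes>\<^bsub>?G\<^esub> ?a = ?b" by (simp add: m_assoc)
  then have "inv\<^bsub>?G\<^esub> ?a \<otimes>\<^bsub>?G\<^esub> (?a \<otimes>\<^bsub>?G\<^esub> ?b \<otimes>\<^bsub>?G\<^esub> ?a) = inv\<^bsub>?G\<^esub> ?a \<otimes>\<^bsub>?G\<^esub> ?b" by simp
  then have ba: "?b \<otimes>\<^bsub>?G\<^esub> ?a = inv\<^bsub>?G\<^esub> ?a \<otimes>\<^bsub>?G\<^esub> ?b"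
    by (simp add: m_assoc[symmetric])
  have bai: "?b \<otimes>\<^bsub>?G\<^esub> ?a [^]\<^bsub>?G\<^esub> i = ?a [^]\<^bsub>?G\<^esub> ((2 * n - 1) * i) \<otimes>\<^bsub>?G\<^esub> ?b" for i :: nat
  proof (induction i)
    case (Suc i)
    have "?b \<otimes>\<^bsub>?G\<^esub> ?a [^]\<^bsub>?G\<^esub> Suc i = ?b \<otimes>\<^bsub>?G\<^esub> ?a [^]\<^bsub>?G\<^esub> i \<otimes>\<^bsub>?G\<^esub> ?a"
      by (simp add: m_assoc)
    also have "\<dots> = ?a [^]\<^bsub>?G\<^esub> ((2 * n - 1) * i) \<otimes>\<^bsub>?G\<^esub> (?b \<otimes>\<^bsub>?G\<^esub> ?a)"
      by (simp add: Suc m_assoc del: One_nat_def)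
    also have "\<dots> = ?a [^]\<^bsub>?G\<^esub> ((2 * n - 1) * i) \<otimes>\<^bsub>?G\<^esub> (?a [^]\<^bsub>?G\<^esub> (2 * n - 1) \<otimes>\<^bsub>?G\<^esub> ?b)"
      by (simp only: ba inva)
    also have "\<dots> = ?a [^]\<^bsub>?G\<^esub> ((2 * n - 1) * i + (2 * n - 1)) \<otimes>\<^bsub>?G\<^esub> ?b"
      by (simp add: m_assoc[symmetric] nat_pow_mult del: One_nat_def)
    also have "(2 * n - 1) * i + (2 * n - 1) = (2 * n - 1) * Suc i" by simp
    finally show ?case .
  qed simp
  have a_step: "?a [^]\<^bsub>?G\<^esub> k \<otimes>\<^bsub>?G\<^esub> g \<in> ?N" if "g \<in> ?N" for g and k :: nat
  proof -
    obtain i j :: nat where j: "j < 2"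
      and g: "g = ?a [^]\<^bsub>?G\<^esub> i \<otimes>\<^bsub>?G\<^esub> ?b [^]\<^bsub>?G\<^esub> j" using \<open>g \<in> ?N\<close> by auto
    have "?a [^]\<^bsub>?G\<^esub> k \<otimes>\<^bsub>?G\<^esub> g = ?a [^]\<^bsub>?G\<^esub> (k + i) \<otimes>\<^bsub>?G\<^esub> ?b [^]\<^bsub>?G\<^esub> j"
      by (simp add: g m_assoc[symmetric] nat_pow_mult)
    then show ?thesis using NI[OF j] by simp
  qed
  have b_step: "?b \<otimes>\<^bsub>?G\<^esub> g \<in> ?N" if "g \<in> ?N" for g
  proof -
    obtain i j :: nat where j: "j < 2"
      and g: "g = ?a [^]\<^bsub>?G\<^esub> i \<otimes>\<^bsub>?G\<^esub> ?b [^]\<^bsub>?G\<^esub> j" using \<open>g \<in> ?N\<close> by auto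
    have "?b \<otimes>\<^bsub>?G\<^esub> g = ?a [^]\<^bsub>?G\<^esub> ((2 * n - 1) * i) \<otimes>\<^bsub>?G\<^esub> (?b \<otimes>\<^bsub>?G\<^esub> ?b [^]\<^bsub>?G\<^esub> j)"
      by (simp add: g bai m_assoc[symmetric] del: One_nat_def)
    moreover have "?b \<otimes>\<^bsub>?G\<^esub> ?b [^]\<^bsub>?G\<^esub> j \<in> ?N"
    proof (cases "j = 0")
      case True
      then show ?thesis using NI[of 1 0] by simp
    next
      case False
      then have "j = 1" using j by simp
      then show ?thesis using NI[of 0 n] by (simp add: bb)
    qed
    ultimately show ?thesis by (simp only: a_step)
  qed
  have letter_step: "pres_class (dicyclic_rels n) [l] \<otimes>\<^bsub>?G\<^esub> g \<in> ?N" if "g \<in> ?N" for l g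
  proof -
    have g: "g \<in> carrier ?G" using that by auto
    obtain x e where l: "l = (x, e)" by (cases l)
    have inv: "pres_class (dicyclic_rels n) [(GenA, False)] = inv\<^bsub>?G\<^esub> ?a"
      "pres_class (dicyclic_rels n) [(GenB, False)] = inv\<^bsub>?G\<^esub> ?b"
      by (simp_all add: dicyclic_def dic_a_def dic_b_def inv_letter_presented_group)
    consider "l = (GenA, True)" | "l = (GenA, False)" | "l = (GenB, True)" | "l = (GenB, False)"
      by (cases x; cases e) (auto simp: l)
    then show ?thesis
    proof cases
      case 1
      then show ?thesis using a_step[OF that, of 1] by (simp add: dic_a_def[symmetric])
    next
      case 2
      then show ?thesis using a_step[OF that] by (simp only: inv inva)
    next
      case 3
      then show ?thesis using b_step[OF that] by (simp only: dic_b_def)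
    next
      case 4
      then show ?thesis using a_step[OF b_step[OF that], of n] g by (simp add: inv invb m_assoc)
    qed
  qed
  have "pres_class (dicyclic_rels n) u \<in> ?N" for u
  proof (induction u)
    case Nil
    have "pres_class (dicyclic_rels n) [] = \<one>\<^bsub>?G\<^esub>"
      by (simp add: dicyclic_def one_presented_group)
    then show ?case using NI[of 0 0] by simp
  next
    case (Cons l u)
    have "pres_class (dicyclic_rels n) (l # u)
        = pres_class (dicyclic_rels n) [l] \<otimes>\<^bsub>?G\<^esub> pres_class (dicyclic_rels n) u"
      by (simp add: dicyclic_def mult_presented_group)
    then show ?case using letter_step[OF Cons] by (simp only:)
  qed
  then show ?thesis by (fastforce simp: dicyclic_def carrier_presented_group dic_word_class[unfolded dicyclic_def])
qed

lemma order_dicyclic: "n > 0 \<Longrightarrow> order (dicyclic n) = 4 * n"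
  unfolding order_def
  by (simp add: dicyclic_elements card_image[OF inj_on_dicyclic_elements])

end

theory Submission
  imports Defs "HOL.Binomial_Plus"
begin

text \<open>
  Write a subset \<open>A\<close> of the dicyclic group as \<open>a\<^sup>X \<union> a\<^sup>Y b\<close> with \<open>X\<close>, \<open>Y\<close> sets of residues modulo
  \<open>2n\<close>; its cardinality is \<open>2n\<close>, half the order of the group. This cardinality makes products
  and quotients rigid: if \<open>g\<close> is not a product of two elements of \<open>A\<close>, then the injection
  \<open>x \<mapsto> x\<^sup>-\<^sup>1 g\<close> sends \<open>A\<close> into its complement, which has the same size, hence onto it
  (\<open>group.not_in_sum_set_iff\<close>); the same happens for quotients with \<open>x \<mapsto> g x\<close>
  (\<open>group.not_in_diff_set_iff\<close>). In terms of \<open>X\<close>, a missing element forces one of four symmetries: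
  \<^item> a missing product \<open>a\<^sup>m b\<close> forces \<open>X = - X\<close>;
  \<^item> a missing product \<open>a\<^sup>m\<close> forces \<open>m - X\<close> to be the complement of \<open>X\<close>;
  \<^item> a missing quotient \<open>a\<^sup>m b\<close> forces \<open>X + n = X\<close>;
  \<^item> a missing quotient \<open>a\<^sup>m\<close> forces \<open>X + m\<close> to be the complement of \<open>X\<close>.

  The second and the fourth can only occur if \<open>X\<close> has exactly \<open>n\<close> elements. Each of the
  three lower bounds comes from an explicit family of pairs \<open>(X, Y)\<close>.

  Balanced sets: if \<open>X\<close> has \<open>n - 1\<close> elements, contains \<open>1\<close> and omits \<open>-1\<close> and \<open>n + 1\<close>, none of the
  symmetries is possible, so both product set and quotient set are the whole group, for every \<open>Y\<close>.
  This gives \<open>(2n-3 choose n-2) (2n choose n+1)\<close> sets.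

  MDTS sets: for \<open>X = {0}\<close> or \<open>X = {n}\<close> and \<open>Y\<close> the complement of one residue, the quotient set is
  everything, whereas the symmetry \<open>X = - X\<close> does hold and one product is missing. This gives \<open>4n\<close>
  sets.

  MSTD sets: let \<open>X\<close> and \<open>Y\<close> both be exchanged with their complements by translation by \<open>n\<close>. Then
  \<open>a\<^sup>n\<close> is not a quotient. If moreover no reflection \<open>i \<mapsto> r - i\<close> maps \<open>X\<close> to itself, then every
  group element is a product. Here \<open>Y\<close> is determined by an arbitrary subset of the residues below
  \<open>n\<close>, and \<open>X\<close> can be any of the \<open>2n\<close> translates of one reflection-free set, so that there are at
  least \<open>2n \<cdot> 2\<^sup>n\<close> such sets. The reflection-free set has runs of lengths \<open>2, 1, n - 3, 2, 1, n - 3\<close>,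
  alternately inside and outside, around the cycle of residues; a reflection would reverse the
  cyclic order of these lengths, which is impossible when they are distinct, and this is where
  \<open>n \<ge> 6\<close> guarantees enough room.
\<close>

section \<open>Sets of half the size of a group\<close>

text \<open>An injection that moves a half-size set off itself fills the complement by counting.\<close>

lemma half_set_iff:
  assumes "finite S" "inj_on f S" "f ` S \<subseteq> S" "A \<subseteq> S" "2 * card A = card S"
    and "\<And>x. x \<in> A \<Longrightarrow> f x \<notin> A" "x \<in> S"
  shows "x \<in> A \<longleftrightarrow> f x \<notin> A"
proof -
  have fin: "finite A" using assms finite_subset by blast
  have "card (f ` A) = card A" using assms by (intro card_image) (auto intro: inj_on_subset)
  moreover have "card (S - A) = card A" using assms fin by (simp add: card_Diff_subset)
  ultimately have "f ` A = S - A" using assms by (intro card_subset_eq) auto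
  moreover have "f x \<in> f ` A \<longleftrightarrow> x \<in> A" "f x \<in> S"
    using assms by (auto simp: inj_on_image_mem_iff)
  ultimately show ?thesis by blast
qed

lemma card_half:
  assumes "finite S" "inj_on f S" "f ` S \<subseteq> S" "A \<subseteq> S"
    and "\<And>x. x \<in> S \<Longrightarrow> x \<in> A \<longleftrightarrow> f x \<notin> A"
  shows "2 * card A = card S"
proof -
  have fin: "finite A" using assms finite_subset by blast
  have "card (f ` A) = card A" "card (f ` (S - A)) = card (S - A)"
    using assms by (auto intro!: card_image intro: inj_on_subset)
  moreover have "card (f ` A) \<le> card (S - A)" "card (f ` (S - A)) \<le> card A"
    using assms fin by (auto intro!: card_mono)
  moreover have "card (S - A) = card S - card A" "card A \<le> card S"
    using assms fin by (auto simp: card_Diff_subset intro: card_mono)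
  ultimately show ?thesis by linarith
qed

lemma (in group) sum_set_subset: "A \<subseteq> carrier G \<Longrightarrow> sum_set G A \<subseteq> carrier G"
  by (auto simp: sum_set_eq)

lemma (in group) diff_set_subset: "A \<subseteq> carrier G \<Longrightarrow> diff_set G A \<subseteq> carrier G"
  by (auto simp: diff_set_eq)

text \<open>
  If \<open>g\<close> is not a product of two elements of \<open>A\<close>, then \<open>x \<mapsto> x\<^sup>-\<^sup>1 g\<close> maps \<open>A\<close> off itself, because
  \<open>x (x\<^sup>-\<^sup>1 g) = g\<close>. As \<open>A\<close> fills half of the group, the map exchanges \<open>A\<close> and its complement.
\<close>

lemma (in group) not_in_sum_set_iff:
  assumes A: "A \<subseteq> carrier G" "finite (carrier G)" "2 * card A = card (carrier G)"
    and g: "g \<in> carrier G" "g \<notin> sum_set G A" and x: "x \<in> carrier G"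
  shows "x \<in> A \<longleftrightarrow> inv x \<otimes> g \<notin> A"
proof (rule half_set_iff[where S = "carrier G"])
  show "inj_on (\<lambda>x. inv x \<otimes> g) (carrier G)"
    using g by (auto intro!: inj_onI dest: inv_inj[THEN inj_onD])
  fix y assume y: "y \<in> A"
  then have "y \<otimes> (inv y \<otimes> g) = g" using A g by (subst m_assoc[symmetric]) auto
  then show "inv y \<otimes> g \<notin> A"
    using y g by (auto simp: sum_set_eq)
qed (use A g x in auto)

text \<open>The same argument with \<open>x \<mapsto> g x\<close>, because \<open>(g x) x\<^sup>-\<^sup>1 = g\<close>.\<close>

lemma (in group) not_in_diff_set_iff:
  assumes A: "A \<subseteq> carrier G" "finite (carrier G)" "2 * card A = card (carrier G)"
    and g: "g \<in> carrier G" "g \<notin> diff_set G A" and x: "x \<in> carrier G"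
  shows "x \<in> A \<longleftrightarrow> g \<otimes> x \<notin> A"
proof (rule half_set_iff[where S = "carrier G"])
  show "inj_on (\<lambda>x. g \<otimes> x) (carrier G)"
    using g by (auto intro!: inj_onI)
  fix y assume y: "y \<in> A"
  then have "g \<otimes> y \<otimes> inv y = g" using A g by (subst m_assoc) auto
  then show "g \<otimes> y \<notin> A"
    using y g by (auto simp: diff_set_eq)
qed (use A g x in auto)

section \<open>Coordinates on the dicyclic group\<close>

locale dicyclic_group =
  fixes n :: nat
  assumes pos: "n > 0"
begin

abbreviation G where "G \<equiv> dicyclic n"
abbreviation N :: int where "N \<equiv> 2 * int n"

sublocale group G by (rule group_dicyclic)

lemma a_closed [simp]: "dic_a n \<in> carrier G" and b_closed [simp]: "dic_b n \<in> carrier G"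
  by (rule dic_a_closed dic_b_closed)+

text \<open>
  The exponents are integers rather than residues, so that the multiplication table below needs no
  reduction; equality is congruence of exponents (\<open>elt_eq_iff\<close>). As in a dihedral group, the
  elements without a factor \<open>b\<close> are called rotations below and the others flips.
\<close>

definition elt :: "int \<Rightarrow> bool \<Rightarrow> dic_gen word set" where
  "elt i e = (if e then dic_a n [^]\<^bsub>G\<^esub> i \<otimes>\<^bsub>G\<^esub> dic_b n else dic_a n [^]\<^bsub>G\<^esub> i)"

lemma elt_closed [simp]: "elt i e \<in> carrier G"
  by (simp add: elt_def)

lemma a_b_a: "dic_a n \<otimes>\<^bsub>G\<^esub> dic_b n \<otimes>\<^bsub>G\<^esub> dic_a n = dic_b n"
proof -
  have "dic_b n \<otimes>\<^bsub>G\<^esub> (inv\<^bsub>G\<^esub> dic_b n \<otimes>\<^bsub>G\<^esub> dic_a n \<otimes>\<^bsub>G\<^esub> dic_b n) = dic_b n \<otimes>\<^bsub>G\<^esub> inv\<^bsub>G\<^esub> dic_a n"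
    by (simp only: dicyclic_relations(3))
  then have "dic_a n \<otimes>\<^bsub>G\<^esub> dic_b n = dic_b n \<otimes>\<^bsub>G\<^esub> inv\<^bsub>G\<^esub> dic_a n"
    by (simp add: m_assoc[symmetric])
  then show ?thesis by (simp add: m_assoc)
qed

lemma pow_b_pow: "dic_a n [^]\<^bsub>G\<^esub> k \<otimes>\<^bsub>G\<^esub> dic_b n \<otimes>\<^bsub>G\<^esub> dic_a n [^]\<^bsub>G\<^esub> k = dic_b n" for k :: nat
proof (induction k)
  case (Suc k)
  have "dic_a n [^]\<^bsub>G\<^esub> k \<otimes>\<^bsub>G\<^esub> dic_a n \<otimes>\<^bsub>G\<^esub> dic_b n \<otimes>\<^bsub>G\<^esub> (dic_a n \<otimes>\<^bsub>G\<^esub> dic_a n [^]\<^bsub>G\<^esub> k)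
      = dic_a n [^]\<^bsub>G\<^esub> k \<otimes>\<^bsub>G\<^esub> (dic_a n \<otimes>\<^bsub>G\<^esub> dic_b n \<otimes>\<^bsub>G\<^esub> dic_a n) \<otimes>\<^bsub>G\<^esub> dic_a n [^]\<^bsub>G\<^esub> k"
    by (simp add: m_assoc)
  then show ?case using Suc nat_pow_Suc2[of "dic_a n" k] by (simp add: a_b_a)
qed simp

lemma b_pow: "dic_b n \<otimes>\<^bsub>G\<^esub> dic_a n [^]\<^bsub>G\<^esub> i = dic_a n [^]\<^bsub>G\<^esub> (- i) \<otimes>\<^bsub>G\<^esub> dic_b n" for i :: int
proof (cases "i \<ge> 0")
  case True
  then obtain k where i: "i = int k" using nonneg_int_cases by blast
  have "inv\<^bsub>G\<^esub> (dic_a n [^]\<^bsub>G\<^esub> k) \<otimes>\<^bsub>G\<^esub> (dic_a n [^]\<^bsub>G\<^esub> k \<otimes>\<^bsub>G\<^esub> dic_b n \<otimes>\<^bsub>G\<^esub> dic_a n [^]\<^bsub>G\<^esub> k)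
      = inv\<^bsub>G\<^esub> (dic_a n [^]\<^bsub>G\<^esub> k) \<otimes>\<^bsub>G\<^esub> dic_b n"
    by (simp only: pow_b_pow)
  then show ?thesis
    by (simp add: i int_pow_int int_pow_neg m_assoc[symmetric])
next
  case False
  then obtain k where i: "i = - int k" by (metis linear nonpos_int_cases)
  have "dic_a n [^]\<^bsub>G\<^esub> k \<otimes>\<^bsub>G\<^esub> dic_b n \<otimes>\<^bsub>G\<^esub> dic_a n [^]\<^bsub>G\<^esub> k \<otimes>\<^bsub>G\<^esub> inv\<^bsub>G\<^esub> (dic_a n [^]\<^bsub>G\<^esub> k)
      = dic_b n \<otimes>\<^bsub>G\<^esub> inv\<^bsub>G\<^esub> (dic_a n [^]\<^bsub>G\<^esub> k)"
    by (simp only: pow_b_pow)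
  then show ?thesis
    by (simp add: i int_pow_int int_pow_neg m_assoc)
qed

lemma b_b: "dic_b n \<otimes>\<^bsub>G\<^esub> dic_b n = dic_a n [^]\<^bsub>G\<^esub> int n"
  by (simp add: int_pow_int dicyclic_relations(2) numeral_2_eq_2)

lemma elt_mult [simp]:
  "elt i False \<otimes>\<^bsub>G\<^esub> elt j e = elt (i + j) e"
  "elt i True \<otimes>\<^bsub>G\<^esub> elt j False = elt (i - j) True"
  "elt i True \<otimes>\<^bsub>G\<^esub> elt j True = elt (i - j + int n) False"
proof -
  show "elt i False \<otimes>\<^bsub>G\<^esub> elt j e = elt (i + j) e"
    by (simp add: elt_def int_pow_mult m_assoc[symmetric])
  have *: "elt i True \<otimes>\<^bsub>G\<^esub> dic_a n [^]\<^bsub>G\<^esub> j = elt (i - j) True"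
    using int_pow_mult[of "dic_a n" i "- j"] by (simp add: elt_def m_assoc b_pow)
  then show "elt i True \<otimes>\<^bsub>G\<^esub> elt j False = elt (i - j) True"
    by (simp add: elt_def)
  have "elt i True \<otimes>\<^bsub>G\<^esub> elt j True = elt i True \<otimes>\<^bsub>G\<^esub> dic_a n [^]\<^bsub>G\<^esub> j \<otimes>\<^bsub>G\<^esub> dic_b n"
    using elt_closed[of i True] by (simp add: elt_def[of j] m_assoc)
  also have "\<dots> = dic_a n [^]\<^bsub>G\<^esub> (i - j) \<otimes>\<^bsub>G\<^esub> (dic_b n \<otimes>\<^bsub>G\<^esub> dic_b n)"
    unfolding * by (simp add: elt_def m_assoc)
  finally show "elt i True \<otimes>\<^bsub>G\<^esub> elt j True = elt (i - j + int n) False"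
    by (simp add: b_b int_pow_mult elt_def)
qed

lemma a_pow_N: "dic_a n [^]\<^bsub>G\<^esub> N = \<one>\<^bsub>G\<^esub>"
  using dicyclic_relations(1)[of n] int_pow_int[of G "dic_a n" "2 * n"] by simp

lemma elt_mod: "elt (i mod N) e = elt i e"
proof -
  have "dic_a n [^]\<^bsub>G\<^esub> i = dic_a n [^]\<^bsub>G\<^esub> (N * (i div N) + i mod N)" by simp
  also have "\<dots> = (dic_a n [^]\<^bsub>G\<^esub> N) [^]\<^bsub>G\<^esub> (i div N) \<otimes>\<^bsub>G\<^esub> dic_a n [^]\<^bsub>G\<^esub> (i mod N)"
    by (simp only: int_pow_mult int_pow_pow a_closed)
  finally show ?thesis by (simp add: elt_def a_pow_N)
qed

lemma elt_nat: "elt (int k) e = dic_a n [^]\<^bsub>G\<^esub> k \<otimes>\<^bsub>G\<^esub> dic_b n [^]\<^bsub>G\<^esub> (of_bool e :: nat)"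
  by (simp add: elt_def int_pow_int)

lemma elt_eq_iff: "elt i e = elt j f \<longleftrightarrow> i mod N = j mod N \<and> e = f"
proof
  assume eq: "elt i e = elt j f"
  define k where "k = nat (i mod N)"
  define l where "l = nat (j mod N)"
  have kl: "i mod N = int k" "j mod N = int l" "k < 2 * n" "l < 2 * n"
    using pos by (auto simp: k_def l_def nat_less_iff)
  have "elt (int k) e = elt (int l) f" using eq elt_mod[of i e] elt_mod[of j f] kl by simp
  then have "(k, of_bool e :: nat) = (l, of_bool f)"
    using kl by (intro inj_onD[OF inj_on_dicyclic_elements[OF pos]]) (auto simp: elt_nat)
  then show "i mod N = j mod N \<and> e = f" by (auto simp: kl of_bool_eq_iff)
next
  assume "i mod N = j mod N \<and> e = f"
  then show "elt i e = elt j f" using elt_mod[of i e] elt_mod[of j e] by simp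
qed

lemma carrier_cases:
  assumes "g \<in> carrier G"
  obtains i e where "g = elt i e"
proof -
  obtain k j where "j < (2::nat)" "g = dic_a n [^]\<^bsub>G\<^esub> (k::nat) \<otimes>\<^bsub>G\<^esub> dic_b n [^]\<^bsub>G\<^esub> j"
    using assms by (auto simp: dicyclic_elements[OF pos])
  moreover have "j = of_bool (j = 1)" using \<open>j < 2\<close> by auto
  ultimately show ?thesis using that[of "int k" "j = 1"] by (metis elt_nat)
qed

lemma inv_elt [simp]:
  "inv\<^bsub>G\<^esub> elt i False = elt (- i) False"
  "inv\<^bsub>G\<^esub> elt i True = elt (i + int n) True"
proof -
  have one: "\<one>\<^bsub>G\<^esub> = elt 0 False" by (simp add: elt_def)
  show "inv\<^bsub>G\<^esub> elt i False = elt (- i) False" by (rule inv_equality) (simp_all add: one)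
  show "inv\<^bsub>G\<^esub> elt i True = elt (i + int n) True"
    by (rule inv_equality) (simp_all add: one elt_eq_iff)
qed

lemma finite_carrier [simp]: "finite (carrier G)" and card_carrier: "card (carrier G) = 4 * n"
proof -
  show "card (carrier G) = 4 * n" using order_dicyclic[OF pos] by (simp add: order_def)
  then show "finite (carrier G)" using pos card_gt_0_iff by fastforce
qed

abbreviation Z :: "int set" where "Z \<equiv> {0..<N}"

lemma mod_in_Z [simp]: "i mod N \<in> Z"
  using pos by simp

lemma Z_mod: "i \<in> Z \<Longrightarrow> i mod N = i"
  by simp

lemma Z_eqI: "i \<in> Z \<Longrightarrow> j \<in> Z \<Longrightarrow> N dvd i - j \<Longrightarrow> i = j"
  by (metis Z_mod mod_eq_dvd_iff)

lemma card_Z: "card Z = 2 * n"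
  by simp

definition rot_flip_set :: "int set \<Rightarrow> int set \<Rightarrow> dic_gen word set set" where
  "rot_flip_set X Y = (\<lambda>i. elt i False) ` X \<union> (\<lambda>j. elt j True) ` Y"

lemma elt_in_rot_flip_set:
  assumes "X \<subseteq> Z" "Y \<subseteq> Z"
  shows "elt i False \<in> rot_flip_set X Y \<longleftrightarrow> i mod N \<in> X" "elt i True \<in> rot_flip_set X Y \<longleftrightarrow> i mod N \<in> Y"
proof -
  have "x mod N = x" if "x \<in> X \<union> Y" for x using that assms Z_mod by blast
  then show "elt i False \<in> rot_flip_set X Y \<longleftrightarrow> i mod N \<in> X" "elt i True \<in> rot_flip_set X Y \<longleftrightarrow> i mod N \<in> Y"
    unfolding rot_flip_set_def by (force simp: elt_eq_iff image_iff)+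
qed

lemma rot_flip_set_subset: "rot_flip_set X Y \<subseteq> carrier G"
  by (auto simp: rot_flip_set_def)

lemma card_rot_flip_set:
  assumes "X \<subseteq> Z" "Y \<subseteq> Z"
  shows "card (rot_flip_set X Y) = card X + card Y"
proof -
  have inj: "inj_on (\<lambda>i. elt i e) Z" for e
    by (rule inj_onI) (metis elt_eq_iff Z_mod)
  have fin: "finite X" "finite Y" using assms finite_subset by blast+
  have "card (rot_flip_set X Y) = card ((\<lambda>i. elt i False) ` X) + card ((\<lambda>j. elt j True) ` Y)"
    unfolding rot_flip_set_def using fin by (intro card_Un_disjoint) (auto simp: elt_eq_iff)
  then show ?thesis
    using assms by (simp add: card_image inj_on_subset[OF inj])
qed

lemma rot_flip_set_eqD:
  assumes "X \<subseteq> Z" "Y \<subseteq> Z" "X' \<subseteq> Z" "Y' \<subseteq> Z" "rot_flip_set X Y = rot_flip_set X' Y'"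
  shows "X = X' \<and> Y = Y'"
proof -
  have "i \<in> X \<longleftrightarrow> i \<in> X'" "i \<in> Y \<longleftrightarrow> i \<in> Y'" if "i \<in> Z" for i
    using elt_in_rot_flip_set[OF assms(1,2), of i] elt_in_rot_flip_set[OF assms(3,4), of i]
      Z_mod[OF that] assms(5)
    by auto
  then show ?thesis using assms(1-4) by blast
qed

text \<open>
  Every \<open>A\<close> comes from only one pair \<open>(X, Y)\<close> of sets of residues, so counting pairs with a
  property bounds the number of subsets with that property from below.
\<close>

lemma card_family_le:
  assumes "\<And>X Y. (X, Y) \<in> F \<Longrightarrow>
    X \<subseteq> Z \<and> Y \<subseteq> Z \<and> card X + card Y = 2 * n \<and> P (rot_flip_set X Y)"
  shows "card F \<le> card {A. A \<subseteq> carrier G \<and> card A = 2 * n \<and> P A}"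
proof -
  have "inj_on (\<lambda>(X, Y). rot_flip_set X Y) F"
  proof (rule inj_onI, clarify)
    fix X Y X' Y' assume "(X, Y) \<in> F" "(X', Y') \<in> F" "rot_flip_set X Y = rot_flip_set X' Y'"
    then show "X = X' \<and> Y = Y'" using assms rot_flip_set_eqD by meson
  qed
  then have "card F = card ((\<lambda>(X, Y). rot_flip_set X Y) ` F)" by (simp add: card_image)
  also have "\<dots> \<le> card {A. A \<subseteq> carrier G \<and> card A = 2 * n \<and> P A}"
  proof (rule card_mono)
    show "finite {A. A \<subseteq> carrier G \<and> card A = 2 * n \<and> P A}" by simp
    show "(\<lambda>(X, Y). rot_flip_set X Y) ` F \<subseteq> {A. A \<subseteq> carrier G \<and> card A = 2 * n \<and> P A}"
    proof (rule image_subsetI, clarify)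
      fix X Y assume "(X, Y) \<in> F"
      from assms[OF this]
      show "rot_flip_set X Y \<subseteq> carrier G \<and> card (rot_flip_set X Y) = 2 * n \<and> P (rot_flip_set X Y)"
        using card_rot_flip_set[of X Y] rot_flip_set_subset[of X Y] by simp
    qed
  qed
  finally show ?thesis .
qed

section \<open>Symmetries forced by a missing product or quotient\<close>

text \<open>
  For a flip \<open>g = a\<^sup>m b\<close>, the exchange of \<open>A\<close> with its complement passes from \<open>X\<close> to \<open>Y\<close> and, applied
  to a flip, back from \<open>Y\<close> to \<open>X\<close>. Composing both steps is conjugation by \<open>g\<close>, which inverts the
  rotations, for products and multiplication by \<open>g\<^sup>2 = a\<^sup>n\<close> for quotients, and this composite must
  preserve \<open>X\<close>. For a rotation \<open>g = a\<^sup>m\<close>, already the first step stays among the rotations.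
\<close>

context
  fixes X Y :: "int set"
  assumes XY: "X \<subseteq> Z" "Y \<subseteq> Z" "card X + card Y = 2 * n"
begin

lemma missing_flip_sum:
  assumes "elt m True \<notin> sum_set G (rot_flip_set X Y)"
  shows "(- i) mod N \<in> X \<longleftrightarrow> i mod N \<in> X"
proof -
  note iff = not_in_sum_set_iff[OF rot_flip_set_subset finite_carrier _ elt_closed assms elt_closed]
  have "i mod N \<in> X \<longleftrightarrow> (m - i) mod N \<notin> Y"
    using iff[of i False] by (simp add: card_rot_flip_set card_carrier XY elt_in_rot_flip_set)
  moreover have "(m - i) mod N \<in> Y \<longleftrightarrow> (- i) mod N \<notin> X"
  proof -
    have "(m - i + int n - m + int n) mod N = (- i + N) mod N" by (simp add: algebra_simps)
    then show ?thesis
      using iff[of "m - i" True] by (simp add: card_rot_flip_set card_carrier XY elt_in_rot_flip_set)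
  qed
  ultimately show ?thesis by blast
qed

lemma missing_rotation_sum:
  assumes "elt m False \<notin> sum_set G (rot_flip_set X Y)"
  shows "i mod N \<in> X \<longleftrightarrow> (m - i) mod N \<notin> X"
  using not_in_sum_set_iff[OF rot_flip_set_subset finite_carrier _ elt_closed assms elt_closed, of i False]
  by (simp add: card_rot_flip_set card_carrier XY elt_in_rot_flip_set)

lemma missing_flip_diff:
  assumes "elt m True \<notin> diff_set G (rot_flip_set X Y)"
  shows "(i + int n) mod N \<in> X \<longleftrightarrow> i mod N \<in> X"
proof -
  note iff = not_in_diff_set_iff[OF rot_flip_set_subset finite_carrier _ elt_closed assms elt_closed]
  have "i mod N \<in> X \<longleftrightarrow> (m - i) mod N \<notin> Y"
    using iff[of i False] by (simp add: card_rot_flip_set card_carrier XY elt_in_rot_flip_set)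
  moreover have "(m - i) mod N \<in> Y \<longleftrightarrow> (i + int n) mod N \<notin> X"
    using iff[of "m - i" True] by (simp add: card_rot_flip_set card_carrier XY elt_in_rot_flip_set)
  ultimately show ?thesis by blast
qed

lemma missing_rotation_diff:
  assumes "elt m False \<notin> diff_set G (rot_flip_set X Y)"
  shows "(i + m) mod N \<in> X \<longleftrightarrow> i mod N \<notin> X"
  using not_in_diff_set_iff[OF rot_flip_set_subset finite_carrier _ elt_closed assms elt_closed, of i False]
  by (simp add: card_rot_flip_set card_carrier XY elt_in_rot_flip_set add.commute)

end

text \<open>
  The rotations impose their symmetry only on sets that contain exactly half of the residues.
\<close>

lemma card_half_reflection:
  assumes "X \<subseteq> Z" "\<And>i. i mod N \<in> X \<longleftrightarrow> (m - i) mod N \<notin> X"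
  shows "card X = n"
proof -
  have "2 * card X = card Z"
  proof (rule card_half[where f = "\<lambda>i. (m - i) mod N"])
    show "inj_on (\<lambda>i. (m - i) mod N) Z"
      by (rule inj_on_inverseI[where g = "\<lambda>i. (m - i) mod N"]) (simp add: mod_simps)
    show "i \<in> X \<longleftrightarrow> (m - i) mod N \<notin> X" if "i \<in> Z" for i
      using assms(2)[of i] Z_mod[OF that] by simp
  qed (use assms pos in auto)
  then show ?thesis by simp
qed

lemma card_half_translation:
  assumes "X \<subseteq> Z" "\<And>i. (i + m) mod N \<in> X \<longleftrightarrow> i mod N \<notin> X"
  shows "card X = n"
proof -
  have "2 * card X = card Z"
  proof (rule card_half[where f = "\<lambda>i. (i + m) mod N"])
    show "inj_on (\<lambda>i. (i + m) mod N) Z"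
      by (rule inj_on_inverseI[where g = "\<lambda>i. (i - m) mod N"]) (simp add: mod_simps)
    show "i \<in> X \<longleftrightarrow> (i + m) mod N \<notin> X" if "i \<in> Z" for i
      using assms(2)[of i] Z_mod[OF that] by simp
  qed (use assms pos in auto)
  then show ?thesis by simp
qed

lemma sum_set_full:
  assumes XY: "X \<subseteq> Z" "Y \<subseteq> Z" "card X + card Y = 2 * n"
    and "card X \<noteq> n" "i mod N \<in> X" "(- i) mod N \<notin> X"
  shows "sum_set G (rot_flip_set X Y) = carrier G"
proof (rule subset_antisym[OF sum_set_subset[OF rot_flip_set_subset]], rule subsetI)
  fix g assume "g \<in> carrier G"
  then obtain m e where g: "g = elt m e" by (rule carrier_cases)
  show "g \<in> sum_set G (rot_flip_set X Y)"
    using missing_flip_sum[OF XY, of m i] missing_rotation_sum[OF XY, of m]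
      card_half_reflection[OF XY(1), of m] assms(4-) by (cases e) (auto simp: g)
qed

lemma diff_set_full:
  assumes XY: "X \<subseteq> Z" "Y \<subseteq> Z" "card X + card Y = 2 * n"
    and "card X \<noteq> n" "i mod N \<in> X" "(i + int n) mod N \<notin> X"
  shows "diff_set G (rot_flip_set X Y) = carrier G"
proof (rule subset_antisym[OF diff_set_subset[OF rot_flip_set_subset]], rule subsetI)
  fix g assume "g \<in> carrier G"
  then obtain m e where g: "g = elt m e" by (rule carrier_cases)
  show "g \<in> diff_set G (rot_flip_set X Y)"
    using missing_flip_diff[OF XY, of m i] missing_rotation_diff[OF XY, of m]
      card_half_translation[OF XY(1), of m] assms(4-) by (cases e) (auto simp: g)
qed

section \<open>Sets with more quotients than products\<close>

text \<open>
  Both choices of \<open>c\<close> satisfy \<open>c = - c\<close> modulo \<open>2n\<close>. Therefore \<open>a\<^sup>c\<close> commutes with every \<open>a\<^sup>j b\<close>, and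
  removing \<open>a\<^sup>m b\<close> from \<open>A\<close> prevents \<open>a\<^sup>c\<^sup>+\<^sup>m b\<close> from being a product in either order.
\<close>

lemma MDTS_rot_flip_set_singleton:
  assumes "n \<ge> 2" "c \<in> {0, int n}" "m \<in> Z"
  shows "MDTS G (rot_flip_set {c} (Z - {m}))"
proof -
  have sub: "{c} \<subseteq> Z" "Z - {m} \<subseteq> Z" using assms by auto
  have card: "card {c} + card (Z - {m}) = 2 * n" using assms by simp
  have "diff_set G (rot_flip_set {c} (Z - {m})) = carrier G"
  proof (rule diff_set_full[OF sub card, of c])
    have "(c + int n) mod N = (if c = 0 then int n else 0)" using assms by auto
    then show "(c + int n) mod N \<notin> {c}" using assms by auto
  qed (use assms in auto)
  moreover have "elt (c + m) True \<notin> sum_set G (rot_flip_set {c} (Z - {m}))"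
  proof
    assume "elt (c + m) True \<in> sum_set G (rot_flip_set {c} (Z - {m}))"
    then obtain x y where "x \<in> rot_flip_set {c} (Z - {m})" "y \<in> rot_flip_set {c} (Z - {m})"
      and "elt (c + m) True = x \<otimes>\<^bsub>G\<^esub> y"
      by (auto simp: sum_set_eq)
    then obtain j where j: "j \<in> Z" "j \<noteq> m"
      and "(c + m) mod N = (c + j) mod N \<or> (c + m) mod N = (j - c) mod N"
      unfolding rot_flip_set_def by (fastforce simp: elt_eq_iff simp del: atLeastLessThan_iff)
    then have "N dvd m - j \<or> N dvd m - j + 2 * c"
      by (auto simp: mod_eq_dvd_iff algebra_simps)
    \<comment> \<open>the congruence \<open>c = - c\<close> merges the two cases\<close>
    moreover have "N dvd 2 * c" using assms by auto
    ultimately have "N dvd m - j" using dvd_add_left_iff by blast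
    then show False using Z_eqI[OF assms(3) j(1)] j(2) by blast
  qed
  then have "sum_set G (rot_flip_set {c} (Z - {m})) \<subset> carrier G"
    using sum_set_subset[OF rot_flip_set_subset] elt_closed by blast
  then show ?thesis
    unfolding MDTS_def by (metis calculation finite_carrier psubset_card_mono)
qed

lemma num_MDTS_ge:
  assumes "n \<ge> 2"
  shows "num_MDTS G (2 * n) \<ge> 4 * n"
proof -
  define F where "F = {0, int n} \<times> Z"
  have "inj_on (\<lambda>(c, m). ({c}, Z - {m})) F"
    by (rule inj_onI) (auto simp: F_def)
  then have "4 * n = card ((\<lambda>(c, m). ({c}, Z - {m})) ` F)"
    using pos by (simp add: card_image F_def card_cartesian_product)
  also have "\<dots> \<le> num_MDTS G (2 * n)"
    unfolding num_MDTS_def using assms MDTS_rot_flip_set_singleton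
    by (intro card_family_le) (auto simp: F_def)
  finally show ?thesis .
qed

section \<open>Balanced sets\<close>

text \<open>
  The residue \<open>1 \<in> X\<close> witnesses that \<open>X\<close> is neither symmetric, as \<open>-1\<close> is missing, nor \<open>n\<close>-periodic,
  as \<open>n + 1\<close> is missing, so every group element is both a product and a quotient.
\<close>

lemma balanced_rot_flip_set:
  assumes "X \<subseteq> Z" "Y \<subseteq> Z" "card X + card Y = 2 * n" "card X \<noteq> n"
    and "1 \<in> X" "N - 1 \<notin> X" "int n + 1 \<notin> X" "n \<ge> 2"
  shows "balanced G (rot_flip_set X Y)"
proof -
  have "1 mod N = 1" "(- 1) mod N = N - 1" "(1 + int n) mod N = 1 + int n"
    using assms(8) by (auto simp: zmod_minus1)
  then show ?thesis
    using assms sum_set_full[of X Y 1, OF assms(1-4)] diff_set_full[of X Y 1, OF assms(1-4)]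
    by (simp add: balanced_def add.commute)
qed

lemma num_balanced_ge:
  assumes "n \<ge> 3"
  shows "num_balanced G (2 * n) \<ge> ((2 * n - 3) choose (n - 2)) * ((2 * n) choose (n + 1))"
proof -
  define R where "R = Z - {1, N - 1, int n + 1}"
  define F where "F = insert 1 ` {S. S \<subseteq> R \<and> card S = n - 2} \<times> {Y. Y \<subseteq> Z \<and> card Y = n + 1}"
  have R: "finite R" "card R = 2 * n - 3"
  proof -
    have "card R = card Z - card {1, N - 1, int n + 1}"
      unfolding R_def using assms by (intro card_Diff_subset) auto
    also have "card {1, N - 1, int n + 1} = 3" using assms by (auto simp: card_insert_if)
    finally show "card R = 2 * n - 3" by simp
  qed (simp add: R_def)
  have "inj_on (insert 1) {S. S \<subseteq> R \<and> card S = n - 2}"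
    by (rule inj_onI) (auto simp: R_def)
  then have "((2 * n - 3) choose (n - 2)) * ((2 * n) choose (n + 1)) = card F"
    using R card_Z by (simp add: F_def card_cartesian_product card_image n_subsets)
  also have "\<dots> \<le> num_balanced G (2 * n)"
    unfolding num_balanced_def
  proof (rule card_family_le)
    fix X Y assume "(X, Y) \<in> F"
    then obtain S where S: "S \<subseteq> R" "card S = n - 2" "X = insert 1 S" and Y: "Y \<subseteq> Z" "card Y = n + 1"
      by (auto simp: F_def)
    have "finite S" "1 \<notin> S" using S(1) R(1) finite_subset by (auto simp: R_def)
    then have "card X = n - 1" using S assms by simp
    moreover have "X \<subseteq> Z" "1 \<in> X" "N - 1 \<notin> X" "int n + 1 \<notin> X"
      using S assms by (auto simp: R_def)
    ultimately show "X \<subseteq> Z \<and> Y \<subseteq> Z \<and> card X + card Y = 2 * n \<and> balanced G (rot_flip_set X Y)"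
      using Y assms by (auto intro!: balanced_rot_flip_set simp del: atLeastLessThan_iff)
  qed
  finally show ?thesis .
qed

section \<open>Sets with more products than quotients\<close>

definition antiperiodic :: "int set \<Rightarrow> bool" where
  "antiperiodic X \<longleftrightarrow> X \<subseteq> Z \<and> (\<forall>i. (i + int n) mod N \<in> X \<longleftrightarrow> i mod N \<notin> X)"

lemma antiperiodicD: "antiperiodic X \<Longrightarrow> (i + int n) mod N \<in> X \<longleftrightarrow> i mod N \<notin> X"
  by (simp add: antiperiodic_def)

text \<open>
  For antiperiodic \<open>X\<close> the two symmetries forced by a missing product both make \<open>X\<close> invariant under
  a reflection: the complement
  \<open>m - X\<close> of \<open>X\<close> is also \<open>X + n\<close>, so that \<open>X = m + n - X\<close>. On the other hand, as
  \<open>Y\<close> is antiperiodic too, multiplication by \<open>a\<^sup>n\<close> maps the whole set to its complement, so \<open>a\<^sup>n\<close> is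
  not a quotient.
\<close>

lemma MSTD_rot_flip_set:
  assumes X: "antiperiodic X" and Y: "antiperiodic Y"
    and asym: "\<And>r. \<not> (\<forall>i. i mod N \<in> X \<longleftrightarrow> (r - i) mod N \<in> X)"
  shows "MSTD G (rot_flip_set X Y)" "card X + card Y = 2 * n"
proof -
  have sub: "X \<subseteq> Z" "Y \<subseteq> Z" using X Y by (auto simp: antiperiodic_def)
  show card: "card X + card Y = 2 * n"
    using card_half_translation[of X "int n"] card_half_translation[of Y "int n"] X Y
    by (simp add: antiperiodic_def)
  have "g \<in> sum_set G (rot_flip_set X Y)" if gG: "g \<in> carrier G" for g
  proof (rule ccontr)
    assume not: "g \<notin> sum_set G (rot_flip_set X Y)"
    obtain m e where g: "g = elt m e" using gG by (rule carrier_cases)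
    show False
    proof (cases e)
      case True
      then show False
        using asym[of 0] missing_flip_sum[OF sub card, of m] not g by simp
    next
      case False
      have "i mod N \<in> X \<longleftrightarrow> (m + int n - i) mod N \<in> X" for i
      proof -
        have "(m + int n - i) mod N \<in> X \<longleftrightarrow> (m - i) mod N \<notin> X"
          using antiperiodicD[OF X, of "m - i"] by (simp add: algebra_simps)
        then show ?thesis using missing_rotation_sum[OF sub card, of m i] not g False by simp
      qed
      then show False using asym by blast
    qed
  qed
  then have "sum_set G (rot_flip_set X Y) = carrier G"
    using sum_set_subset[OF rot_flip_set_subset] by blast
  moreover have "elt (int n) False \<notin> diff_set G (rot_flip_set X Y)"
  proof
    assume "elt (int n) False \<in> diff_set G (rot_flip_set X Y)"
    then obtain x y where xy: "x \<in> rot_flip_set X Y" "y \<in> rot_flip_set X Y"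
      and "elt (int n) False = x \<otimes>\<^bsub>G\<^esub> inv\<^bsub>G\<^esub> y"
      by (auto simp: diff_set_eq)
    then have "elt (int n) False \<otimes>\<^bsub>G\<^esub> y = x"
      using rot_flip_set_subset[of X Y] by (auto simp: m_assoc subset_iff)
    then have "elt (int n) False \<otimes>\<^bsub>G\<^esub> y \<in> rot_flip_set X Y" using xy by simp
    moreover obtain i e where "y = elt i e"
      using xy rot_flip_set_subset by (meson carrier_cases subsetD)
    ultimately show False
      using xy(2) antiperiodicD[OF X, of i] antiperiodicD[OF Y, of i]
      by (cases e) (simp_all add: elt_in_rot_flip_set[OF sub] add.commute)
  qed
  then have "diff_set G (rot_flip_set X Y) \<subset> carrier G"
    using diff_set_subset[OF rot_flip_set_subset] elt_closed by blast
  ultimately show "MSTD G (rot_flip_set X Y)"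
    unfolding MSTD_def by (metis finite_carrier psubset_card_mono)
qed

text \<open>The antiperiodic set that agrees with \<open>S\<close> below \<open>n\<close>.\<close>

definition antiperiodic_ext :: "int set \<Rightarrow> int set" where
  "antiperiodic_ext S = {i \<in> Z. if i < int n then i \<in> S else i - int n \<notin> S}"

lemma antiperiodic_antiperiodic_ext: "antiperiodic (antiperiodic_ext S)"
proof -
  have "(i + int n) mod N \<in> antiperiodic_ext S \<longleftrightarrow> i mod N \<notin> antiperiodic_ext S" for i
  proof -
    define r where "r = i mod N"
    have r: "0 \<le> r" "r < N" using pos by (auto simp: r_def)
    have "(i + int n) mod N = (r + int n) mod N" by (simp add: r_def mod_simps)
    also have "\<dots> = (if r < int n then r + int n else r - int n)"
      using r minus_mod_self2[of "r + int n" N, symmetric] by auto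
    finally show ?thesis using r by (simp add: antiperiodic_ext_def flip: r_def)
  qed
  then show ?thesis by (simp add: antiperiodic_def) (auto simp: antiperiodic_ext_def)
qed

lemma inj_on_antiperiodic_ext: "inj_on antiperiodic_ext (Pow {0..<int n})"
proof (rule inj_on_inverseI[where g = "\<lambda>X. X \<inter> {0..<int n}"])
  show "antiperiodic_ext S \<inter> {0..<int n} = S" if "S \<in> Pow {0..<int n}" for S
    using that by (auto simp: antiperiodic_ext_def)
qed

definition shift :: "int \<Rightarrow> int set \<Rightarrow> int set" where
  "shift t X = {k \<in> Z. (k - t) mod N \<in> X}"

lemma mod_in_shift: "k mod N \<in> shift t X \<longleftrightarrow> (k - t) mod N \<in> X"
  by (simp add: shift_def mod_simps del: atLeastLessThan_iff)

lemma antiperiodic_shift: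
  assumes "antiperiodic X"
  shows "antiperiodic (shift t X)"
proof -
  have "(i + int n - t) mod N \<in> X \<longleftrightarrow> (i - t) mod N \<notin> X" for i
    using antiperiodicD[OF assms, of "i - t"] by (simp add: algebra_simps)
  moreover have "shift t X \<subseteq> Z" by (auto simp: shift_def)
  ultimately show ?thesis by (simp only: antiperiodic_def mod_in_shift simp_thms)
qed

text \<open>
  For \<open>n \<ge> 6\<close> this is \<open>{0, 1} \<union> {3, \<dots>, n - 1} \<union> {n + 2}\<close>. The element \<open>n + 2\<close> is the only
  one without a neighbour in the set, so every translation or reflection that preserves the set fixes
  \<open>n + 2\<close>.
\<close>

definition skew_set :: "int set" where "skew_set = antiperiodic_ext ({0..<int n} - {2})"

context
  assumes n6: "n \<ge> 6"
begin

lemma skew_set_isolated_iff: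
  "(k - 1) mod N \<notin> skew_set \<and> k mod N \<in> skew_set \<and> (k + 1) mod N \<notin> skew_set \<longleftrightarrow> k mod N = int n + 2"
proof -
  define r where "r = k mod N"
  have r: "0 \<le> r" "r < N" using pos by (auto simp: r_def)
  have "(k + 1) mod N = (r + 1) mod N" "(k - 1) mod N = (r - 1) mod N"
    by (simp_all add: r_def mod_simps)
  moreover have "(r + 1) mod N = (if r = N - 1 then 0 else r + 1)" using r by auto
  moreover have "(r - 1) mod N = (if r = 0 then N - 1 else r - 1)"
    using r by (auto simp: zmod_minus1)
  ultimately show ?thesis
    using r n6 by (auto simp: skew_set_def antiperiodic_ext_def simp flip: r_def)
qed

lemma skew_set_no_period:
  assumes "\<And>k. k mod N \<in> skew_set \<longleftrightarrow> (k + d) mod N \<in> skew_set"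
  shows "N dvd d"
proof -
  have iso: "(int n + 2) mod N = int n + 2" using n6 by simp
  have "(int n + 2 + d) mod N = (int n + 2) mod N"
    using skew_set_isolated_iff[of "int n + 2"] skew_set_isolated_iff[of "int n + 2 + d"]
      assms[of "int n + 2"] assms[of "int n + 2 - 1"] assms[of "int n + 2 + 1"] iso
    by (simp add: algebra_simps)
  then show ?thesis by (simp add: mod_eq_dvd_iff)
qed

text \<open>
  The only reflection fixing \<open>n + 2\<close> is \<open>k \<mapsto> 4 - k\<close>, because \<open>2 (n + 2)\<close> is congruent to \<open>4\<close>; it maps
  the element \<open>5\<close> to \<open>-1\<close>, outside the set. That \<open>5\<close> is an element requires \<open>n \<ge> 6\<close>.
\<close>

lemma skew_set_no_reflection: "\<not> (\<forall>k. k mod N \<in> skew_set \<longleftrightarrow> (r - k) mod N \<in> skew_set)"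
proof
  assume refl: "\<forall>k. k mod N \<in> skew_set \<longleftrightarrow> (r - k) mod N \<in> skew_set"
  have iso: "(int n + 2) mod N = int n + 2" using n6 by simp
  have "(r - (int n + 2)) mod N = (int n + 2) mod N"
    using skew_set_isolated_iff[of "int n + 2"] skew_set_isolated_iff[of "r - (int n + 2)"] iso
      refl[rule_format, of "int n + 2"] refl[rule_format, of "int n + 2 - 1"]
      refl[rule_format, of "int n + 2 + 1"]
    by (simp add: algebra_simps)
  then have "N dvd r - 4 - N" by (simp add: mod_eq_dvd_iff algebra_simps)
  then have "N dvd r - 4" by (simp add: dvd_diff_left_iff)
  then have "(r - 5) mod N = (- 1) mod N" by (simp add: mod_eq_dvd_iff)
  then have "(r - 5) mod N = N - 1" using n6 by (simp add: zmod_minus1)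
  moreover have "5 mod N \<in> skew_set" "N - 1 \<notin> skew_set"
    using n6 by (auto simp: skew_set_def antiperiodic_ext_def)
  ultimately show False using refl by metis
qed

lemma num_MSTD_ge: "num_MSTD G (2 * n) \<ge> 2 * n * 2 ^ n"
proof -
  define F where "F = (\<lambda>t. shift t skew_set) ` Z \<times> antiperiodic_ext ` Pow {0..<int n}"
  have antiper: "antiperiodic skew_set" by (simp add: skew_set_def antiperiodic_antiperiodic_ext)
  have "inj_on (\<lambda>t. shift t skew_set) Z"
  proof (rule inj_onI)
    fix t u assume tu: "t \<in> Z" "u \<in> Z" and eq: "shift t skew_set = shift u skew_set"
    have "k mod N \<in> skew_set \<longleftrightarrow> (k + (t - u)) mod N \<in> skew_set" for k
      using mod_in_shift[of "k + t" t skew_set] mod_in_shift[of "k + t" u skew_set] eq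
      by (simp add: algebra_simps)
    then show "t = u" using skew_set_no_period Z_eqI tu by blast
  qed
  then have "2 * n * 2 ^ n = card F"
    by (simp add: F_def card_cartesian_product card_image inj_on_antiperiodic_ext card_Pow)
  also have "\<dots> \<le> num_MSTD G (2 * n)"
    unfolding num_MSTD_def
  proof (rule card_family_le)
    fix X Y assume "(X, Y) \<in> F"
    then obtain t where t: "X = shift t skew_set" and Y: "antiperiodic Y"
      by (auto simp: F_def antiperiodic_antiperiodic_ext)
    have X: "antiperiodic X" using t antiper antiperiodic_shift by simp
    have asym: "\<not> (\<forall>i. i mod N \<in> X \<longleftrightarrow> (r - i) mod N \<in> X)" for r
    proof
      assume *: "\<forall>i. i mod N \<in> X \<longleftrightarrow> (r - i) mod N \<in> X"
      have "k mod N \<in> skew_set \<longleftrightarrow> (r - 2 * t - k) mod N \<in> skew_set" for k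
        using *[rule_format, of "k + t"] unfolding t mod_in_shift by (simp add: algebra_simps)
      then show False using skew_set_no_reflection by blast
    qed
    show "X \<subseteq> Z \<and> Y \<subseteq> Z \<and> card X + card Y = 2 * n \<and> MSTD G (rot_flip_set X Y)"
      using MSTD_rot_flip_set[OF X Y asym] X Y by (simp add: antiperiodic_def)
  qed
  finally show ?thesis .
qed

end

end

section \<open>Comparison of the counts\<close>

text \<open>
  Dropping the parity condition, the sum is part of a hockey-stick sum for
  \<open>(2n - 2) choose (n - 2)\<close>.
\<close>

lemma sum_choose_odd_le:
  assumes "n \<ge> 3"
  shows "(\<Sum>i | i \<in> {3..n + 3} \<and> odd i. (2 * n - i) choose (n - 3)) \<le> (2 * n) choose n"
proof -
  let ?I = "{i. i \<in> {3..n + 3} \<and> odd i}"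
  have "inj_on (\<lambda>i. 2 * n - i) ?I"
    using assms by (auto intro!: inj_onI)
  then have "(\<Sum>i\<in>?I. (2 * n - i) choose (n - 3)) = (\<Sum>k\<in>(\<lambda>i. 2 * n - i) ` ?I. k choose (n - 3))"
    by (simp add: sum.reindex)
  also have "\<dots> \<le> (\<Sum>k\<le>2 * n - 3. k choose (n - 3))"
    by (rule sum_mono2) auto
  also have "\<dots> = (2 * n - 2) choose (n - 2)"
  proof -
    have "Suc (2 * n - 3) = 2 * n - 2" "Suc (n - 3) = n - 2" using assms by auto
    then show ?thesis using sum_choose_upper[of "n - 3" "2 * n - 3"] by metis
  qed
  also have "\<dots> \<le> (2 * n) choose (n - 2)"
    by (rule binomial_right_mono) simp
  also have "\<dots> \<le> (2 * n) choose n" by (rule binomial_maximum')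
  finally show ?thesis .
qed

lemma le_choose:
  assumes "0 < k" "k < m"
  shows "m \<le> m choose k"
  using assms
proof (induction m arbitrary: k)
  case (Suc m)
  obtain j where k: "k = Suc j" using Suc.prems by (cases k) auto
  show ?case
  proof (cases "k = m")
    case False
    then have "m \<le> m choose k" "0 < m choose j" using Suc k by auto
    then show ?thesis unfolding k binomial_Suc_Suc by linarith
  qed (simp add: binomial_symmetric)
qed simp

text \<open>
  Passing from \<open>(2n choose n)\<close> to \<open>(2n choose n+1)\<close> costs a factor \<open>n / (n + 1)\<close>, so the first factor
  on the right must be at least \<open>(n + 1)\<^sup>2 / n\<close>, for which \<open>n + 3\<close> suffices.
\<close>

lemma choose_product_ge:
  assumes "n \<ge> 6"
  shows "(n + 1) * ((2 * n) choose n) \<le> ((2 * n - 3) choose (n - 2)) * ((2 * n) choose (n + 1))"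
proof -
  have "n + 3 \<le> (2 * n - 3) choose (n - 2)"
    using assms le_choose[of "n - 2" "2 * n - 3"] by linarith
  then have *: "(n + 3) * ((2 * n) choose (n + 1))
      \<le> ((2 * n - 3) choose (n - 2)) * ((2 * n) choose (n + 1))"
    by (rule mult_le_mono1)
  have absorb: "(n + 1) * ((2 * n) choose (n + 1)) = n * ((2 * n) choose n)"
    using binomial_absorb_comp[of "2 * n" n] Suc_times_binomial[of n "2 * n - 1"] assms by simp
  have "(n + 1) * ((n + 1) * ((2 * n) choose n)) \<le> (n + 3) * (n * ((2 * n) choose n))"
    using assms by (simp add: algebra_simps)
  also have "\<dots> = (n + 1) * ((n + 3) * ((2 * n) choose (n + 1)))"
    unfolding absorb[symmetric] by (simp only: ac_simps)
  finally have "(n + 1) * ((2 * n) choose n) \<le> (n + 3) * ((2 * n) choose (n + 1))"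
    by (rule mult_left_le_imp_le) simp
  then show ?thesis using * by (rule order_trans)
qed

theorem theorem1p9:
  fixes n :: nat
  assumes "n \<ge> 6"
  shows "(even n \<longrightarrow>
            int (num_MSTD (dicyclic n) (2 * n)) \<ge> (int n + 1) * (7 * 2 ^ (n - 3) - 4) \<and>
            num_MDTS (dicyclic n) (2 * n) \<ge> 2 * (n + 1) \<and>
            num_balanced (dicyclic n) (2 * n)
              \<ge> (n + 1) * (\<Sum>i | i \<in> {3..n + 3} \<and> odd i. (2 * n - i) choose (n - 3)))
       \<and> (odd n \<longrightarrow>
            int (num_MSTD (dicyclic n) (2 * n)) \<ge> (int n + 1) * (7 * 2 ^ (n - 3) - 4) \<and>
            num_MDTS (dicyclic n) (2 * n) \<ge> 0 \<and>
            int (num_balanced (dicyclic n) (2 * n))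
              \<ge> int ((2 * n) choose n) * (int n + 1) - 2 ^ n * (int n + 1))"
proof -
  interpret dicyclic_group n using assms by unfold_locales simp
  have S: "(int n + 1) * (7 * 2 ^ (n - 3) - 4) \<le> int (num_MSTD (dicyclic n) (2 * n))"
  proof -
    have "(int n + 1) * (7 * 2 ^ (n - 3) - 4) \<le> (2 * int n) * (8 * 2 ^ (n - 3))"
    proof (rule mult_mono)
      have "1 \<le> (2 :: int) ^ (n - 3)" by simp
      then show "7 * 2 ^ (n - 3) - 4 \<le> 8 * (2 :: int) ^ (n - 3)" "0 \<le> 7 * 2 ^ (n - 3) - (4 :: int)"
        by linarith+
    qed (use assms in auto)
    also have "8 * 2 ^ (n - 3) = (2 :: int) ^ n"
      using assms power_add[of "2 :: int" 3 "n - 3"] by simp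
    also have "2 * int n * 2 ^ n = int (2 * n * 2 ^ n)" by simp
    also have "\<dots> \<le> int (num_MSTD (dicyclic n) (2 * n))"
      using num_MSTD_ge[OF assms] by (simp only: of_nat_le_iff)
    finally show ?thesis .
  qed
  have D: "2 * (n + 1) \<le> num_MDTS (dicyclic n) (2 * n)"
    using num_MDTS_ge assms by simp
  have B: "(n + 1) * ((2 * n) choose n) \<le> num_balanced (dicyclic n) (2 * n)"
    by (rule order_trans[OF choose_product_ge[OF assms] num_balanced_ge]) (use assms in simp)
  have B_even: "(n + 1) * (\<Sum>i | i \<in> {3..n + 3} \<and> odd i. (2 * n - i) choose (n - 3))
      \<le> num_balanced (dicyclic n) (2 * n)"
    by (rule order_trans[OF mult_le_mono2[OF sum_choose_odd_le] B]) (use assms in simp)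
  have B_odd: "int ((2 * n) choose n) * (int n + 1) - 2 ^ n * (int n + 1)
      \<le> int (num_balanced (dicyclic n) (2 * n))"
  proof -
    have "int ((2 * n) choose n) * (int n + 1) = int ((n + 1) * ((2 * n) choose n))"
      by (simp add: algebra_simps)
    also have "\<dots> \<le> int (num_balanced (dicyclic n) (2 * n))" using B by (simp only: of_nat_le_iff)
    finally show ?thesis by (simp add: le_diff_eq add_increasing2 diff_le_eq)
  qed
  show ?thesis using S D B_even B_odd by simp
qed

end
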